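(* Let $L$ be a Leibniz algebra over a field $F$ and let $V$ be an $L$-module. Then there exists a unique submodule $W$ of $V$ such that every composition factor of $W$ is inner relative to $V$ and every composition factor of $V/W$ is outer relative to $V$. (Here composition factors of $W$ are the composition factors $A/B$ of $V$ with $B\subset A\subseteq W$, and composition factors of $V/W$ are identified with the composition factors $A/B$ of $V$ with $W\subseteq B\subset A$.)
   Context: A (left) Leibniz algebra is an algebra $L$ over a field $F$ with $a(bc)=(ab)c+b(ac)$ for all $a,b,c\in L$. $\mathrm{Leib}(L)$ denotes the linear span of $\{x^2:x\in L\}$, which is a two-sided ideal. An $L$-module is a (bi)module $V$: a vector space with bilinear left and right actions $xv,vx\in V$ such that $X=L\oplus V$, with $V\cdot V=0$ and the given products, is a Leibniz algebra; $X$ is called the split extension of $V$ by $L$. Submodules are subspaces invariant under both actions; they are ideals of $X$ contained in $V$. A composition factor of $V$ is a quotient $A/B$ where $B\subset A$ are submodules of $V$ and $A/B$ is irreducible. With $X$ the split extension of $V$ by $L$, the composition factor $A/B$ is called inner relative to $V$ if $A/B\subseteq \mathrm{Leib}(X/B)$, and outer (relative to $V$) otherwise. *)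

theory Defs
  imports "HOL-Algebra.Module" "HOL-Algebra.QuotRing"
begin

text \<open>
  An algebra is a vector space given as a HOL-Algebra module over a field whose \<^const>\<open>mult\<close>
  component is the (not necessarily associative) product; the component \<^const>\<open>one\<close>
  of such records carries no meaning here and is never constrained.
\<close>

locale leibniz_algebra = field F + module F L for F (structure) and L (structure) +
  assumes prod_closed:
      "\<lbrakk>a \<in> carrier L; b \<in> carrier L\<rbrakk> \<Longrightarrow> a \<otimes>\<^bsub>L\<^esub> b \<in> carrier L"
    and prod_add_left:
      "\<lbrakk>a \<in> carrier L; b \<in> carrier L; c \<in> carrier L\<rbrakk> \<Longrightarrow>
        (a \<oplus>\<^bsub>L\<^esub> b) \<otimes>\<^bsub>L\<^esub> c = (a \<otimes>\<^bsub>L\<^esub> c) \<oplus>\<^bsub>L\<^esub> (b \<otimes>\<^bsub>L\<^esub> c)"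
    and prod_add_right:
      "\<lbrakk>a \<in> carrier L; b \<in> carrier L; c \<in> carrier L\<rbrakk> \<Longrightarrow>
        a \<otimes>\<^bsub>L\<^esub> (b \<oplus>\<^bsub>L\<^esub> c) = (a \<otimes>\<^bsub>L\<^esub> b) \<oplus>\<^bsub>L\<^esub> (a \<otimes>\<^bsub>L\<^esub> c)"
    and prod_smult_left:
      "\<lbrakk>k \<in> carrier F; a \<in> carrier L; b \<in> carrier L\<rbrakk> \<Longrightarrow>
        (k \<odot>\<^bsub>L\<^esub> a) \<otimes>\<^bsub>L\<^esub> b = k \<odot>\<^bsub>L\<^esub> (a \<otimes>\<^bsub>L\<^esub> b)"
    and prod_smult_right:
      "\<lbrakk>k \<in> carrier F; a \<in> carrier L; b \<in> carrier L\<rbrakk> \<Longrightarrow>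
        a \<otimes>\<^bsub>L\<^esub> (k \<odot>\<^bsub>L\<^esub> b) = k \<odot>\<^bsub>L\<^esub> (a \<otimes>\<^bsub>L\<^esub> b)"
    and leibniz_identity:
      "\<lbrakk>a \<in> carrier L; b \<in> carrier L; c \<in> carrier L\<rbrakk> \<Longrightarrow>
        a \<otimes>\<^bsub>L\<^esub> (b \<otimes>\<^bsub>L\<^esub> c) = ((a \<otimes>\<^bsub>L\<^esub> b) \<otimes>\<^bsub>L\<^esub> c) \<oplus>\<^bsub>L\<^esub> (b \<otimes>\<^bsub>L\<^esub> (a \<otimes>\<^bsub>L\<^esub> c))"

definition lin_span ::
    "('f, 'm) ring_scheme \<Rightarrow> ('f, 'a, 'n) module_scheme \<Rightarrow> 'a set \<Rightarrow> 'a set" where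
  "lin_span F M S = \<Inter>{N. submodule N F M \<and> S \<subseteq> N}"

definition Leib :: "('f, 'm) ring_scheme \<Rightarrow> ('f, 'a, 'n) module_scheme \<Rightarrow> 'a set" where
  "Leib F L = lin_span F L {x \<otimes>\<^bsub>L\<^esub> x | x. x \<in> carrier L}"

definition quot_algebra :: "('f, 'a, 'n) module_scheme \<Rightarrow> 'a set \<Rightarrow> ('f, 'a set) module" where
  "quot_algebra M I =
    \<lparr>carrier = a_rcosets\<^bsub>M\<^esub> I, mult = rcoset_mult M I, one = I +>\<^bsub>M\<^esub> \<one>\<^bsub>M\<^esub>,
     zero = I, add = set_add M, smult = (\<lambda>k C. \<Union>x\<in>C. I +>\<^bsub>M\<^esub> (k \<odot>\<^bsub>M\<^esub> x))\<rparr>"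

text \<open>
  \<open>lact V x v\<close> and \<open>ract V v x\<close> are the products \<open>xv\<close> and \<open>vx\<close>. The inherited component
  \<^const>\<open>mult\<close> of a bimodule is meaningless.
\<close>

record ('f, 'v, 'a) bimodule = "('f, 'v) module" +
  lact :: "'a \<Rightarrow> 'v \<Rightarrow> 'v"
  ract :: "'v \<Rightarrow> 'a \<Rightarrow> 'v"

definition split_ext ::
    "('f, 'a, 'n) module_scheme \<Rightarrow> ('f, 'v, 'a, 'p) bimodule_scheme \<Rightarrow> ('f, 'a \<times> 'v) module" where
  "split_ext L V =
    \<lparr>carrier = carrier L \<times> carrier V,
     mult = (\<lambda>(a, v) (b, w). (a \<otimes>\<^bsub>L\<^esub> b, lact V a w \<oplus>\<^bsub>V\<^esub> ract V v b)),
     one = (\<one>\<^bsub>L\<^esub>, \<one>\<^bsub>V\<^esub>),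
     zero = (\<zero>\<^bsub>L\<^esub>, \<zero>\<^bsub>V\<^esub>),
     add = (\<lambda>(a, v) (b, w). (a \<oplus>\<^bsub>L\<^esub> b, v \<oplus>\<^bsub>V\<^esub> w)),
     smult = (\<lambda>k (a, v). (k \<odot>\<^bsub>L\<^esub> a, k \<odot>\<^bsub>V\<^esub> v))\<rparr>"

locale leibniz_module = L?: leibniz_algebra F L + V?: module F V
    for F :: "('f, 'm) ring_scheme" (structure)
    and L :: "('f, 'a, 'n) module_scheme" (structure)
    and V :: "('f, 'v, 'a, 'p) bimodule_scheme" (structure) +
  assumes lact_closed:
      "\<lbrakk>x \<in> carrier L; v \<in> carrier V\<rbrakk> \<Longrightarrow> lact V x v \<in> carrier V"
    and ract_closed:
      "\<lbrakk>x \<in> carrier L; v \<in> carrier V\<rbrakk> \<Longrightarrow> ract V v x \<in> carrier V"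
    and lact_add_left:
      "\<lbrakk>x \<in> carrier L; y \<in> carrier L; v \<in> carrier V\<rbrakk> \<Longrightarrow>
        lact V (x \<oplus>\<^bsub>L\<^esub> y) v = lact V x v \<oplus>\<^bsub>V\<^esub> lact V y v"
    and lact_add_right:
      "\<lbrakk>x \<in> carrier L; v \<in> carrier V; w \<in> carrier V\<rbrakk> \<Longrightarrow>
        lact V x (v \<oplus>\<^bsub>V\<^esub> w) = lact V x v \<oplus>\<^bsub>V\<^esub> lact V x w"
    and lact_smult_left:
      "\<lbrakk>k \<in> carrier F; x \<in> carrier L; v \<in> carrier V\<rbrakk> \<Longrightarrow>
        lact V (k \<odot>\<^bsub>L\<^esub> x) v = k \<odot>\<^bsub>V\<^esub> lact V x v"
    and lact_smult_right:
      "\<lbrakk>k \<in> carrier F; x \<in> carrier L; v \<in> carrier V\<rbrakk> \<Longrightarrow>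
        lact V x (k \<odot>\<^bsub>V\<^esub> v) = k \<odot>\<^bsub>V\<^esub> lact V x v"
    and ract_add_left:
      "\<lbrakk>x \<in> carrier L; v \<in> carrier V; w \<in> carrier V\<rbrakk> \<Longrightarrow>
        ract V (v \<oplus>\<^bsub>V\<^esub> w) x = ract V v x \<oplus>\<^bsub>V\<^esub> ract V w x"
    and ract_add_right:
      "\<lbrakk>x \<in> carrier L; y \<in> carrier L; v \<in> carrier V\<rbrakk> \<Longrightarrow>
        ract V v (x \<oplus>\<^bsub>L\<^esub> y) = ract V v x \<oplus>\<^bsub>V\<^esub> ract V v y"
    and ract_smult_left:
      "\<lbrakk>k \<in> carrier F; x \<in> carrier L; v \<in> carrier V\<rbrakk> \<Longrightarrow>
        ract V (k \<odot>\<^bsub>V\<^esub> v) x = k \<odot>\<^bsub>V\<^esub> ract V v x"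
    and ract_smult_right:
      "\<lbrakk>k \<in> carrier F; x \<in> carrier L; v \<in> carrier V\<rbrakk> \<Longrightarrow>
        ract V v (k \<odot>\<^bsub>L\<^esub> x) = k \<odot>\<^bsub>V\<^esub> ract V v x"
    and split_ext_leibniz: "leibniz_algebra F (split_ext L V)"

definition leibniz_submodule ::
    "('f, 'm) ring_scheme \<Rightarrow> ('f, 'a, 'n) module_scheme \<Rightarrow> ('f, 'v, 'a, 'p) bimodule_scheme
      \<Rightarrow> 'v set \<Rightarrow> bool" where
  "leibniz_submodule F L V W \<longleftrightarrow>
    submodule W F V \<and>
    (\<forall>x\<in>carrier L. \<forall>w\<in>W. lact V x w \<in> W \<and> ract V w x \<in> W)"

definition quot_bimodule ::
    "('f, 'v, 'a, 'p) bimodule_scheme \<Rightarrow> 'v set \<Rightarrow> ('f, 'v set, 'a) bimodule" where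
  "quot_bimodule V B =
    \<lparr>carrier = a_rcosets\<^bsub>V\<^esub> B, mult = rcoset_mult V B, one = B +>\<^bsub>V\<^esub> \<one>\<^bsub>V\<^esub>,
     zero = B, add = set_add V, smult = (\<lambda>k C. \<Union>v\<in>C. B +>\<^bsub>V\<^esub> (k \<odot>\<^bsub>V\<^esub> v)),
     lact = (\<lambda>x C. \<Union>v\<in>C. B +>\<^bsub>V\<^esub> lact V x v),
     ract = (\<lambda>C x. \<Union>v\<in>C. B +>\<^bsub>V\<^esub> ract V v x)\<rparr>"

definition irreducible_bimodule ::
    "('f, 'm) ring_scheme \<Rightarrow> ('f, 'a, 'n) module_scheme \<Rightarrow> ('f, 'v, 'a, 'p) bimodule_scheme
      \<Rightarrow> bool" where
  "irreducible_bimodule F L V \<longleftrightarrow>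
    carrier V \<noteq> {\<zero>\<^bsub>V\<^esub>} \<and>
    (\<forall>U. leibniz_submodule F L V U \<longrightarrow> U = {\<zero>\<^bsub>V\<^esub>} \<or> U = carrier V)"

definition composition_factor ::
    "('f, 'm) ring_scheme \<Rightarrow> ('f, 'a, 'n) module_scheme \<Rightarrow> ('f, 'v, 'a, 'p) bimodule_scheme
      \<Rightarrow> 'v set \<Rightarrow> 'v set \<Rightarrow> bool" where
  "composition_factor F L V A B \<longleftrightarrow>
    leibniz_submodule F L V A \<and> leibniz_submodule F L V B \<and> B \<subset> A \<and>
    irreducible_bimodule F L (quot_bimodule (V\<lparr>carrier := A\<rparr>) B)"

text \<open>The copy of a submodule of \<open>V\<close> inside the split extension of \<open>V\<close> by \<open>L\<close>.\<close>

definition in_split_ext :: "('f, 'a, 'n) module_scheme \<Rightarrow> 'v set \<Rightarrow> ('a \<times> 'v) set" where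
  "in_split_ext L A = {\<zero>\<^bsub>L\<^esub>} \<times> A"

definition inner_factor ::
    "('f, 'm) ring_scheme \<Rightarrow> ('f, 'a, 'n) module_scheme \<Rightarrow> ('f, 'v, 'a, 'p) bimodule_scheme
      \<Rightarrow> 'v set \<Rightarrow> 'v set \<Rightarrow> bool" where
  "inner_factor F L V A B \<longleftrightarrow>
    (\<lambda>x. in_split_ext L B +>\<^bsub>split_ext L V\<^esub> x) ` in_split_ext L A
      \<subseteq> Leib F (quot_algebra (split_ext L V) (in_split_ext L B))"

abbreviation outer_factor ::
    "('f, 'm) ring_scheme \<Rightarrow> ('f, 'a, 'n) module_scheme \<Rightarrow> ('f, 'v, 'a, 'p) bimodule_scheme
      \<Rightarrow> 'v set \<Rightarrow> 'v set \<Rightarrow> bool" where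
  "outer_factor F L V A B \<equiv> \<not> inner_factor F L V A B"

end

theory Submission
  imports Defs
begin

text \<open>
  In the split extension \<open>X\<close>, the square of \<open>a + v\<close> is \<open>a\<^sup>2 + (av + va)\<close>, so the part of
  \<open>Leib(X)\<close> in \<open>V\<close> is the span \<open>K\<close> of all \<open>av + va\<close>, and \<open>A/B\<close> is inner if and only if
  \<open>A \<subseteq> K + B\<close>. Thus factors below \<open>K\<close> are inner and factors above \<open>K\<close> are outer. For uniqueness,
  Zorn's lemma yields a composition factor between any two distinct nested submodules: a factor between
  \<open>W\<close> and \<open>K + W\<close> would be inner although it lies above \<open>W\<close>, so \<open>K \<subseteq> W\<close>; a factor between \<open>K\<close>
  and \<open>W\<close> would be outer although it lies below \<open>W\<close>.
\<close>

section \<open>Submodules and quotients\<close>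

context module
begin

text \<open>Closure under negation comes from multiplication by the scalar -1, so later submodule
  proofs only check zero, sums and scalar multiples.\<close>

lemma submoduleI_zero:
  assumes "N \<subseteq> carrier M" "\<zero>\<^bsub>M\<^esub> \<in> N"
    and "\<And>x y. \<lbrakk>x \<in> N; y \<in> N\<rbrakk> \<Longrightarrow> x \<oplus>\<^bsub>M\<^esub> y \<in> N"
    and sm: "\<And>k x. \<lbrakk>k \<in> carrier R; x \<in> N\<rbrakk> \<Longrightarrow> k \<odot>\<^bsub>M\<^esub> x \<in> N"
  shows "submodule N R M"
proof (rule submoduleI)
  fix x assume x: "x \<in> N"
  then have "\<ominus>\<^bsub>M\<^esub> x = (\<ominus> \<one>) \<odot>\<^bsub>M\<^esub> x"
    using assms(1) by (auto simp: smult_l_minus)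
  then show "\<ominus>\<^bsub>M\<^esub> x \<in> N" using sm[of "\<ominus> \<one>" x] x by simp
qed (use assms in auto)

lemma submoduleD:
  assumes "submodule N R M"
  shows "N \<subseteq> carrier M" "\<zero>\<^bsub>M\<^esub> \<in> N"
    and "\<And>x. x \<in> N \<Longrightarrow> x \<in> carrier M"
    and "\<And>x. x \<in> N \<Longrightarrow> \<ominus>\<^bsub>M\<^esub> x \<in> N"
    and "\<And>x y. \<lbrakk>x \<in> N; y \<in> N\<rbrakk> \<Longrightarrow> x \<oplus>\<^bsub>M\<^esub> y \<in> N"
    and "\<And>k x. \<lbrakk>k \<in> carrier R; x \<in> N\<rbrakk> \<Longrightarrow> k \<odot>\<^bsub>M\<^esub> x \<in> N"
proof -
  interpret N: additive_subgroup N M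
    using assms by (simp add: additive_subgroup_def submodule_def)
  show "N \<subseteq> carrier M" "\<zero>\<^bsub>M\<^esub> \<in> N"
    and "\<And>x. x \<in> N \<Longrightarrow> x \<in> carrier M"
    and "\<And>x. x \<in> N \<Longrightarrow> \<ominus>\<^bsub>M\<^esub> x \<in> N"
    and "\<And>x y. \<lbrakk>x \<in> N; y \<in> N\<rbrakk> \<Longrightarrow> x \<oplus>\<^bsub>M\<^esub> y \<in> N"
    using N.a_subset by auto
  show "\<And>k x. \<lbrakk>k \<in> carrier R; x \<in> N\<rbrakk> \<Longrightarrow> k \<odot>\<^bsub>M\<^esub> x \<in> N"
    using submodule.smult_closed[OF assms] .
qed

lemma submodule_Inter:
  assumes "\<And>N. N \<in> \<N> \<Longrightarrow> submodule N R M" "\<N> \<noteq> {}"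
  shows "submodule (\<Inter>\<N>) R M"
proof (rule submoduleI_zero)
  note N = assms(1)[THEN submoduleD(1)] assms(1)[THEN submoduleD(2)]
    assms(1)[THEN submoduleD(5)] assms(1)[THEN submoduleD(6)]
  show "\<Inter>\<N> \<subseteq> carrier M" using assms(2) N(1) by blast
  show "\<zero>\<^bsub>M\<^esub> \<in> \<Inter>\<N>" using N(2) by simp
  show "x \<oplus>\<^bsub>M\<^esub> y \<in> \<Inter>\<N>" if "x \<in> \<Inter>\<N>" "y \<in> \<Inter>\<N>" for x y
    using that N(3) by simp
  show "k \<odot>\<^bsub>M\<^esub> x \<in> \<Inter>\<N>" if "k \<in> carrier R" "x \<in> \<Inter>\<N>" for k x
    using that N(4) by simp
qed

section \<open>Sums of submodules\<close>

lemma set_addI: "\<lbrakk>a \<in> A; b \<in> B\<rbrakk> \<Longrightarrow> a \<oplus>\<^bsub>M\<^esub> b \<in> A <+>\<^bsub>M\<^esub> B"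
  by (auto simp: set_add_def')

lemma set_addE:
  assumes "x \<in> A <+>\<^bsub>M\<^esub> B"
  obtains a b where "a \<in> A" "b \<in> B" "x = a \<oplus>\<^bsub>M\<^esub> b"
  using assms by (auto simp: set_add_def')

lemma submodule_set_add:
  assumes "submodule A R M" "submodule B R M"
  shows "submodule (A <+>\<^bsub>M\<^esub> B) R M"
proof (rule submoduleI_zero)
  note A = submoduleD[OF assms(1)] and B = submoduleD[OF assms(2)]
  show "A <+>\<^bsub>M\<^esub> B \<subseteq> carrier M" using A(1) B(1) by (auto simp: set_add_def')
  show "\<zero>\<^bsub>M\<^esub> \<in> A <+>\<^bsub>M\<^esub> B" using A(2) B(2) by (force simp: set_add_def')
  show "k \<odot>\<^bsub>M\<^esub> x \<in> A <+>\<^bsub>M\<^esub> B" if "k \<in> carrier R" "x \<in> A <+>\<^bsub>M\<^esub> B" for k x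
    using that A(3,6) B(3,6) by (auto elim!: set_addE simp: smult_r_distr intro!: set_addI)
  fix x y assume "x \<in> A <+>\<^bsub>M\<^esub> B" "y \<in> A <+>\<^bsub>M\<^esub> B"
  then obtain a b c d where x: "x = a \<oplus>\<^bsub>M\<^esub> b" "y = c \<oplus>\<^bsub>M\<^esub> d" "a \<in> A" "b \<in> B" "c \<in> A" "d \<in> B"
    by (auto simp: set_add_def')
  then have "x \<oplus>\<^bsub>M\<^esub> y = (a \<oplus>\<^bsub>M\<^esub> c) \<oplus>\<^bsub>M\<^esub> (b \<oplus>\<^bsub>M\<^esub> d)"
    using A(3) B(3) by (simp add: M.a_ac)
  then show "x \<oplus>\<^bsub>M\<^esub> y \<in> A <+>\<^bsub>M\<^esub> B"
    using A(5) B(5) x by (simp add: set_addI)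
qed

lemma set_add_superset:
  assumes "submodule A R M" "submodule B R M"
  shows "A \<subseteq> A <+>\<^bsub>M\<^esub> B" "B \<subseteq> A <+>\<^bsub>M\<^esub> B"
proof -
  note A = submoduleD[OF assms(1)] and B = submoduleD[OF assms(2)]
  show "A \<subseteq> A <+>\<^bsub>M\<^esub> B"
  proof
    fix a assume "a \<in> A"
    then show "a \<in> A <+>\<^bsub>M\<^esub> B" using A(3) set_addI[of a A "\<zero>\<^bsub>M\<^esub>" B] B(2) by simp
  qed
  show "B \<subseteq> A <+>\<^bsub>M\<^esub> B"
  proof
    fix b assume "b \<in> B"
    then show "b \<in> A <+>\<^bsub>M\<^esub> B" using B(3) set_addI[of "\<zero>\<^bsub>M\<^esub>" A b B] A(2) by simp
  qed
qed

lemma set_add_least: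
  assumes "submodule C R M" "A \<subseteq> C" "B \<subseteq> C"
  shows "A <+>\<^bsub>M\<^esub> B \<subseteq> C"
  using assms(2,3) submoduleD(5)[OF assms(1)] by (auto simp: set_add_def')

section \<open>Linear spans, and preimages and images of subspaces\<close>

lemma lin_span_submodule:
  assumes "S \<subseteq> carrier M"
  shows "submodule (lin_span R M S) R M"
  unfolding lin_span_def using assms carrier_is_submodule by (intro submodule_Inter) auto

lemma lin_span_superset: "S \<subseteq> lin_span R M S"
  unfolding lin_span_def by auto

lemma lin_span_least: "\<lbrakk>submodule N R M; S \<subseteq> N\<rbrakk> \<Longrightarrow> lin_span R M S \<subseteq> N"
  unfolding lin_span_def by auto

text \<open>Serves span arguments: a linear map sends a whole span into \<open>U\<close> as soon as
  it sends the generators there. It also pulls subspaces of a quotient back to the original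
  space.\<close>

lemma submodule_vimage:
  assumes "module R Q" and f: "f \<in> carrier M \<rightarrow> carrier Q"
    and fa: "\<And>x y. \<lbrakk>x \<in> carrier M; y \<in> carrier M\<rbrakk> \<Longrightarrow> f (x \<oplus>\<^bsub>M\<^esub> y) = f x \<oplus>\<^bsub>Q\<^esub> f y"
    and fs: "\<And>k x. \<lbrakk>k \<in> carrier R; x \<in> carrier M\<rbrakk> \<Longrightarrow> f (k \<odot>\<^bsub>M\<^esub> x) = k \<odot>\<^bsub>Q\<^esub> f x"
    and U: "submodule U R Q"
  shows "submodule {x \<in> carrier M. f x \<in> U} R M"
proof -
  interpret Q: module R Q by fact
  note U = Q.submoduleD[OF U]
  have "f \<zero>\<^bsub>M\<^esub> = \<zero>\<^bsub>Q\<^esub>" using fs[of \<zero> "\<zero>\<^bsub>M\<^esub>"] funcset_mem[OF f, of "\<zero>\<^bsub>M\<^esub>"] by simp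
  then show ?thesis
    using U by (intro submoduleI_zero) (auto simp: fa fs)
qed

lemma submodule_image:
  assumes "module R Q" and f: "f \<in> carrier M \<rightarrow> carrier Q"
    and fa: "\<And>x y. \<lbrakk>x \<in> carrier M; y \<in> carrier M\<rbrakk> \<Longrightarrow> f (x \<oplus>\<^bsub>M\<^esub> y) = f x \<oplus>\<^bsub>Q\<^esub> f y"
    and fs: "\<And>k x. \<lbrakk>k \<in> carrier R; x \<in> carrier M\<rbrakk> \<Longrightarrow> f (k \<odot>\<^bsub>M\<^esub> x) = k \<odot>\<^bsub>Q\<^esub> f x"
    and U: "submodule U R M"
  shows "submodule (f ` U) R Q"
proof -
  interpret Q: module R Q by fact
  note U = submoduleD[OF U]
  have "f \<zero>\<^bsub>M\<^esub> = \<zero>\<^bsub>Q\<^esub>" using fs[of \<zero> "\<zero>\<^bsub>M\<^esub>"] funcset_mem[OF f, of "\<zero>\<^bsub>M\<^esub>"] by simp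
  then have "\<zero>\<^bsub>Q\<^esub> \<in> f ` U" using U(2) by (metis imageI)
  moreover have "f ` U \<subseteq> carrier Q" using f U(1) by auto
  moreover have "x \<oplus>\<^bsub>Q\<^esub> y \<in> f ` U" if xy: "x \<in> f ` U" "y \<in> f ` U" for x y
  proof -
    obtain a b where "a \<in> U" "b \<in> U" "x = f a" "y = f b" using xy by (elim imageE)
    then have "x \<oplus>\<^bsub>Q\<^esub> y = f (a \<oplus>\<^bsub>M\<^esub> b)" "a \<oplus>\<^bsub>M\<^esub> b \<in> U" using fa U(3,5) by auto
    then show ?thesis by blast
  qed
  moreover have "k \<odot>\<^bsub>Q\<^esub> x \<in> f ` U" if x: "k \<in> carrier R" "x \<in> f ` U" for k x
  proof -
    obtain a where "a \<in> U" "x = f a" using x(2) by (elim imageE)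
    then have "k \<odot>\<^bsub>Q\<^esub> x = f (k \<odot>\<^bsub>M\<^esub> a)" "k \<odot>\<^bsub>M\<^esub> a \<in> U" using fs U(3,6) x(1) by auto
    then show ?thesis by blast
  qed
  ultimately show ?thesis by (intro Q.submoduleI_zero)
qed

text \<open>Composition factors are quotients of \<open>V\<lparr>carrier := A\<rparr>\<close>; this
  moves subspaces between that module and \<open>V\<close> itself.\<close>

lemma submodule_restrict_iff:
  assumes A: "submodule A R M"
  shows "submodule N R (M\<lparr>carrier := A\<rparr>) \<longleftrightarrow> submodule N R M \<and> N \<subseteq> A"
proof -
  interpret A: module R "M\<lparr>carrier := A\<rparr>"
    using submodule.submodule_is_module[OF A module_axioms] .
  show ?thesis
  proof
    assume N: "submodule N R (M\<lparr>carrier := A\<rparr>)"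
    note N = A.submoduleD(1,2,5,6)[OF N, simplified]
    then show "submodule N R M \<and> N \<subseteq> A"
      using submoduleD(1)[OF A] by (auto intro!: submoduleI_zero)
  next
    assume "submodule N R M \<and> N \<subseteq> A"
    then show "submodule N R (M\<lparr>carrier := A\<rparr>)"
      using submoduleD(2,5,6)[of N] by (auto intro!: A.submoduleI_zero)
  qed
qed

section \<open>Cosets and quotient modules\<close>

lemma coset_absorb:
  assumes I: "submodule I R M" and i: "i \<in> I" and x: "x \<in> carrier M"
  shows "I +>\<^bsub>M\<^esub> (i \<oplus>\<^bsub>M\<^esub> x) = I +>\<^bsub>M\<^esub> x"
  using M.a_repr_independence[of "i \<oplus>\<^bsub>M\<^esub> x" I x] M.a_rcosI[OF i submoduleD(1)[OF I] x] I x
  by (simp add: submodule_def)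

lemma coset_self:
  assumes "submodule I R M" and x: "x \<in> carrier M"
  shows "x \<in> I +>\<^bsub>M\<^esub> x"
  using M.a_rcosI[OF submoduleD(2,1) x, of I] assms by simp

lemma coset_eq_self_iff:
  assumes I: "submodule I R M" and x: "x \<in> carrier M"
  shows "I +>\<^bsub>M\<^esub> x = I \<longleftrightarrow> x \<in> I"
  using M.a_coset_join1[of I x] M.a_coset_join2[of x I] assms by (auto simp: submodule_def)

text \<open>Operations on quotients are encoded as unions over all representatives. If each
  representative yields the same set, the union collapses to it, since \<open>I\<close> contains
  zero and hence the coset is nonempty.\<close>

lemma UN_coset_const:
  assumes I: "submodule I R M" and g: "\<And>i. i \<in> I \<Longrightarrow> g (i \<oplus>\<^bsub>M\<^esub> x) = c"
  shows "(\<Union>y\<in>I +>\<^bsub>M\<^esub> x. g y) = c"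
  using g submoduleD(2)[OF I] unfolding a_r_coset_def' by blast

text \<open>Stated for any record with the quotient's module components, so that it covers both
  \<open>quot_algebra\<close> and \<open>quot_bimodule\<close>. The coset map is onto and linear,
  and thereby carries the module axioms over from \<open>M\<close>.\<close>

lemma quotient_module:
  fixes Q :: "('a, 'c set, 'e) module_scheme"
  assumes I: "submodule I R M"
    and Q: "carrier Q = a_rcosets\<^bsub>M\<^esub> I" "zero Q = I" "add Q = set_add M"
    and Qs: "smult Q = (\<lambda>k C. \<Union>x\<in>C. I +>\<^bsub>M\<^esub> (k \<odot>\<^bsub>M\<^esub> x))"
  shows "carrier Q = (\<lambda>x. I +>\<^bsub>M\<^esub> x) ` carrier M"
    and "\<And>x y. \<lbrakk>x \<in> carrier M; y \<in> carrier M\<rbrakk> \<Longrightarrow>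
      I +>\<^bsub>M\<^esub> (x \<oplus>\<^bsub>M\<^esub> y) = (I +>\<^bsub>M\<^esub> x) \<oplus>\<^bsub>Q\<^esub> (I +>\<^bsub>M\<^esub> y)"
    and "\<And>k x. \<lbrakk>k \<in> carrier R; x \<in> carrier M\<rbrakk> \<Longrightarrow>
      I +>\<^bsub>M\<^esub> (k \<odot>\<^bsub>M\<^esub> x) = k \<odot>\<^bsub>Q\<^esub> (I +>\<^bsub>M\<^esub> x)"
    and "module R Q"
proof -
  interpret I: abelian_subgroup I M
    using I M.a_comm_group by (intro abelian_subgroupI2) (auto simp: submodule_def)
  note ID = submoduleD[OF I]
  show c: "carrier Q = (\<lambda>x. I +>\<^bsub>M\<^esub> x) ` carrier M"
    unfolding Q by (auto simp: A_RCOSETS_def')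
  show a: "I +>\<^bsub>M\<^esub> (x \<oplus>\<^bsub>M\<^esub> y) = (I +>\<^bsub>M\<^esub> x) \<oplus>\<^bsub>Q\<^esub> (I +>\<^bsub>M\<^esub> y)"
    if "x \<in> carrier M" "y \<in> carrier M" for x y
    using that by (simp add: Q I.a_rcos_sum)
  show s: "I +>\<^bsub>M\<^esub> (k \<odot>\<^bsub>M\<^esub> x) = k \<odot>\<^bsub>Q\<^esub> (I +>\<^bsub>M\<^esub> x)"
    if k: "k \<in> carrier R" and x: "x \<in> carrier M" for k x
  proof -
    have "(\<Union>y\<in>I +>\<^bsub>M\<^esub> x. I +>\<^bsub>M\<^esub> (k \<odot>\<^bsub>M\<^esub> y)) = I +>\<^bsub>M\<^esub> (k \<odot>\<^bsub>M\<^esub> x)"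
      using k x ID(3,6) by (intro UN_coset_const[OF I]) (simp add: smult_r_distr coset_absorb[OF I])
    then show ?thesis by (simp add: Qs)
  qed
  let ?\<pi> = "\<lambda>x. I +>\<^bsub>M\<^esub> x"
  have c': "?\<pi> x \<in> carrier Q" if "x \<in> carrier M" for x using that c by simp
  \<comment> \<open>\<open>E\<close> chooses representatives; the equations \<open>a\<close> and
    \<open>s\<close>, read from right to left, then turn each axiom for \<open>Q\<close> into one
    for \<open>M\<close>.\<close>
  have E: thesis if "C \<in> carrier Q" "\<And>x. \<lbrakk>x \<in> carrier M; C = ?\<pi> x\<rbrakk> \<Longrightarrow> thesis" for C thesis
    using that c by auto
  have z: "\<zero>\<^bsub>Q\<^esub> = ?\<pi> \<zero>\<^bsub>M\<^esub>" using ID(1) by (simp add: Q)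
  interpret Q: abelian_group Q
  proof (rule abelian_groupI)
    show "\<exists>D\<in>carrier Q. D \<oplus>\<^bsub>Q\<^esub> C = \<zero>\<^bsub>Q\<^esub>" if C: "C \<in> carrier Q" for C
    proof -
      obtain x where "x \<in> carrier M" "C = ?\<pi> x" using C by (rule E)
      then have "?\<pi> (\<ominus>\<^bsub>M\<^esub> x) \<oplus>\<^bsub>Q\<^esub> C = \<zero>\<^bsub>Q\<^esub>" "?\<pi> (\<ominus>\<^bsub>M\<^esub> x) \<in> carrier Q"
        by (simp_all add: z c' M.l_neg flip: a)
      then show ?thesis by blast
    qed
  qed (auto elim!: E simp: z c' M.a_ac simp flip: a)
  show "module R Q"
  proof (rule moduleI)
    show "cring R" "abelian_group Q" by unfold_locales
  qed (auto elim!: E simp: c' smult_l_distr smult_r_distr smult_assoc1 simp flip: a s)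
qed

end

section \<open>Leibniz algebras and modules\<close>

lemma (in leibniz_algebra) prod_zero:
  assumes "x \<in> carrier L"
  shows "x \<otimes>\<^bsub>L\<^esub> \<zero>\<^bsub>L\<^esub> = \<zero>\<^bsub>L\<^esub>" "\<zero>\<^bsub>L\<^esub> \<otimes>\<^bsub>L\<^esub> x = \<zero>\<^bsub>L\<^esub>"
  using prod_smult_right[of \<zero> x "\<zero>\<^bsub>L\<^esub>"] prod_smult_left[of \<zero> "\<zero>\<^bsub>L\<^esub>" x]
    prod_closed[of x "\<zero>\<^bsub>L\<^esub>"] prod_closed[of "\<zero>\<^bsub>L\<^esub>" x] assms
  by simp_all

text \<open>When \<open>(i + x)(j + y)\<close> is expanded, every summand other than
  \<open>xy\<close> lies in the ideal \<open>I\<close>, so all pairs of representatives give the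
  same coset.\<close>

lemma (in leibniz_algebra) quot_algebra_mult:
  assumes I: "submodule I F L"
    and il: "\<And>a i. \<lbrakk>a \<in> carrier L; i \<in> I\<rbrakk> \<Longrightarrow> a \<otimes>\<^bsub>L\<^esub> i \<in> I"
    and ir: "\<And>a i. \<lbrakk>a \<in> carrier L; i \<in> I\<rbrakk> \<Longrightarrow> i \<otimes>\<^bsub>L\<^esub> a \<in> I"
    and x: "x \<in> carrier L" and y: "y \<in> carrier L"
  shows "(I +>\<^bsub>L\<^esub> x) \<otimes>\<^bsub>quot_algebra L I\<^esub> (I +>\<^bsub>L\<^esub> y) = I +>\<^bsub>L\<^esub> (x \<otimes>\<^bsub>L\<^esub> y)"
proof -
  note ID = submoduleD[OF I]
  have "I +>\<^bsub>L\<^esub> ((i \<oplus>\<^bsub>L\<^esub> x) \<otimes>\<^bsub>L\<^esub> (j \<oplus>\<^bsub>L\<^esub> y)) = I +>\<^bsub>L\<^esub> (x \<otimes>\<^bsub>L\<^esub> y)" if "i \<in> I" "j \<in> I" for i j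
    using that x y ID(3) il ir prod_closed
    by (simp add: prod_add_left prod_add_right M.a_assoc coset_absorb[OF I])
  then show ?thesis
    unfolding quot_algebra_def rcoset_mult_def by (simp add: UN_coset_const[OF I])
qed

context leibniz_module
begin

section \<open>The bimodule identities and the symmetrised action\<close>

lemma lact_zero: "x \<in> carrier L \<Longrightarrow> lact V x \<zero>\<^bsub>V\<^esub> = \<zero>\<^bsub>V\<^esub>"
  using lact_smult_right[of \<zero> x "\<zero>\<^bsub>V\<^esub>"] lact_closed[of x "\<zero>\<^bsub>V\<^esub>"] by simp

lemma ract_zero: "x \<in> carrier L \<Longrightarrow> ract V \<zero>\<^bsub>V\<^esub> x = \<zero>\<^bsub>V\<^esub>"
  using ract_smult_left[of \<zero> x "\<zero>\<^bsub>V\<^esub>"] ract_closed[of x "\<zero>\<^bsub>V\<^esub>"] by simp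

lemma lact_null: "v \<in> carrier V \<Longrightarrow> lact V \<zero>\<^bsub>L\<^esub> v = \<zero>\<^bsub>V\<^esub>"
  using lact_smult_left[of \<zero> "\<zero>\<^bsub>L\<^esub>" v] lact_closed[of "\<zero>\<^bsub>L\<^esub>" v] by simp

lemma ract_null: "v \<in> carrier V \<Longrightarrow> ract V v \<zero>\<^bsub>L\<^esub> = \<zero>\<^bsub>V\<^esub>"
  using ract_smult_right[of \<zero> "\<zero>\<^bsub>L\<^esub>" v] ract_closed[of "\<zero>\<^bsub>L\<^esub>" v] by simp

lemma split_ext_simps:
  "carrier (split_ext L V) = carrier L \<times> carrier V"
  "\<zero>\<^bsub>split_ext L V\<^esub> = (\<zero>\<^bsub>L\<^esub>, \<zero>\<^bsub>V\<^esub>)"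
  "(a, v) \<oplus>\<^bsub>split_ext L V\<^esub> (b, w) = (a \<oplus>\<^bsub>L\<^esub> b, v \<oplus>\<^bsub>V\<^esub> w)"
  "(a, v) \<otimes>\<^bsub>split_ext L V\<^esub> (b, w) = (a \<otimes>\<^bsub>L\<^esub> b, lact V a w \<oplus>\<^bsub>V\<^esub> ract V v b)"
  "k \<odot>\<^bsub>split_ext L V\<^esub> (a, v) = (k \<odot>\<^bsub>L\<^esub> a, k \<odot>\<^bsub>V\<^esub> v)"
  by (simp_all add: split_ext_def)

text \<open>These are the Leibniz identity of the split extension on two elements of
  \<open>L\<close> and one of \<open>V\<close>, with \<open>v\<close> in third, second and first
  place respectively.\<close>

lemma action_identities:
  assumes "x \<in> carrier L" "a \<in> carrier L" "v \<in> carrier V"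
  shows "lact V x (lact V a v) = lact V (x \<otimes>\<^bsub>L\<^esub> a) v \<oplus>\<^bsub>V\<^esub> lact V a (lact V x v)"
    and "lact V x (ract V v a) = ract V (lact V x v) a \<oplus>\<^bsub>V\<^esub> ract V v (x \<otimes>\<^bsub>L\<^esub> a)"
    and "ract V v (x \<otimes>\<^bsub>L\<^esub> a) = ract V (ract V v x) a \<oplus>\<^bsub>V\<^esub> lact V x (ract V v a)"
proof -
  note leib = leibniz_algebra.leibniz_identity[OF split_ext_leibniz, unfolded split_ext_simps]
  note simps = split_ext_simps lact_zero ract_zero lact_closed ract_closed L.prod_closed assms
  show "lact V x (lact V a v) = lact V (x \<otimes>\<^bsub>L\<^esub> a) v \<oplus>\<^bsub>V\<^esub> lact V a (lact V x v)"
    using leib[of "(x, \<zero>\<^bsub>V\<^esub>)" "(a, \<zero>\<^bsub>V\<^esub>)" "(\<zero>\<^bsub>L\<^esub>, v)"] by (simp add: simps)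
  show "lact V x (ract V v a) = ract V (lact V x v) a \<oplus>\<^bsub>V\<^esub> ract V v (x \<otimes>\<^bsub>L\<^esub> a)"
    using leib[of "(x, \<zero>\<^bsub>V\<^esub>)" "(\<zero>\<^bsub>L\<^esub>, v)" "(a, \<zero>\<^bsub>V\<^esub>)"] by (simp add: simps)
  show "ract V v (x \<otimes>\<^bsub>L\<^esub> a) = ract V (ract V v x) a \<oplus>\<^bsub>V\<^esub> lact V x (ract V v a)"
    using leib[of "(\<zero>\<^bsub>L\<^esub>, v)" "(x, \<zero>\<^bsub>V\<^esub>)" "(a, \<zero>\<^bsub>V\<^esub>)"] by (simp add: simps)
qed

text \<open>This is the \<open>V\<close>-component of the square of \<open>(a, v)\<close> in the
  split extension.\<close>

definition sym_act :: "'a \<Rightarrow> 'v \<Rightarrow> 'v" where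
  "sym_act a v = lact V a v \<oplus>\<^bsub>V\<^esub> ract V v a"

lemma sym_act_closed: "\<lbrakk>a \<in> carrier L; v \<in> carrier V\<rbrakk> \<Longrightarrow> sym_act a v \<in> carrier V"
  by (simp add: sym_act_def lact_closed ract_closed)

text \<open>By the first two identities, acting by \<open>x\<close> from the left is a derivation
  for both actions, hence for their sum.\<close>

lemma lact_sym_act:
  assumes "x \<in> carrier L" "a \<in> carrier L" "v \<in> carrier V"
  shows "lact V x (sym_act a v) = sym_act (x \<otimes>\<^bsub>L\<^esub> a) v \<oplus>\<^bsub>V\<^esub> sym_act a (lact V x v)"
  using assms
  by (simp add: sym_act_def lact_add_right action_identities(1,2)[OF assms] lact_closed ract_closed
      L.prod_closed V.M.a_ac)

text \<open>The identities give \<open>a(vx) = (av)x + v(ax)\<close> and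
  \<open>v(ax) = (va)x + a(vx)\<close>. Substituting the second into the first and cancelling
  \<open>a(vx)\<close> leaves \<open>(av + va)x = 0\<close>.\<close>

lemma ract_sym_act:
  assumes x: "x \<in> carrier L" and a: "a \<in> carrier L" and v: "v \<in> carrier V"
  shows "ract V (sym_act a v) x = \<zero>\<^bsub>V\<^esub>"
proof -
  let ?s = "ract V (lact V a v) x \<oplus>\<^bsub>V\<^esub> ract V (ract V v a) x" and ?t = "lact V a (ract V v x)"
  have c: "?s \<in> carrier V" "?t \<in> carrier V" using assms by (simp_all add: lact_closed ract_closed)
  have "?t = ract V (lact V a v) x \<oplus>\<^bsub>V\<^esub> (ract V (ract V v a) x \<oplus>\<^bsub>V\<^esub> ?t)"
    using action_identities(2,3)[OF a x v] by simp
  also have "\<dots> = ?s \<oplus>\<^bsub>V\<^esub> ?t" using assms by (simp add: lact_closed ract_closed V.M.a_assoc)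
  finally have "?s = \<zero>\<^bsub>V\<^esub>" using c by (metis V.M.add.r_cancel_one')
  then show ?thesis using assms by (simp add: sym_act_def ract_add_left lact_closed ract_closed)
qed

text \<open>The subspace K of the overview. It is the smallest submodule modulo which the left and
  right actions are negatives of each other.\<close>

definition inner_core :: "'v set" where
  "inner_core = lin_span F V {sym_act a v | a v. a \<in> carrier L \<and> v \<in> carrier V}"

lemma sym_act_in_inner_core: "\<lbrakk>a \<in> carrier L; v \<in> carrier V\<rbrakk> \<Longrightarrow> sym_act a v \<in> inner_core"
  using V.lin_span_superset unfolding inner_core_def by fastforce

lemma inner_core_least:
  assumes "submodule N F V" "\<And>a v. \<lbrakk>a \<in> carrier L; v \<in> carrier V\<rbrakk> \<Longrightarrow> sym_act a v \<in> N"
  shows "inner_core \<subseteq> N"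
  unfolding inner_core_def using assms by (intro V.lin_span_least) auto

text \<open>For fixed \<open>x\<close>, the vectors that \<open>x\<close> sends into the span form a
  subspace. It contains the generators: by the derivation rule for the left action, and because the
  right action kills them.\<close>

lemma inner_core_submodule: "leibniz_submodule F L V inner_core"
proof -
  have K: "submodule inner_core F V"
    unfolding inner_core_def using sym_act_closed by (intro V.lin_span_submodule) auto
  have "inner_core \<subseteq> {w \<in> carrier V. lact V x w \<in> inner_core}" if x: "x \<in> carrier L" for x
  proof (rule inner_core_least)
    show "submodule {w \<in> carrier V. lact V x w \<in> inner_core} F V"
      using x K by (intro V.submodule_vimage[OF V.module_axioms])
        (auto simp: lact_closed lact_add_right lact_smult_right)
  qed (use x K sym_act_in_inner_core in \<open>simp add: sym_act_closed lact_sym_act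
         V.submoduleD(5)[OF K] L.prod_closed lact_closed\<close>)
  moreover have "inner_core \<subseteq> {w \<in> carrier V. ract V w x \<in> inner_core}" if x: "x \<in> carrier L" for x
  proof (rule inner_core_least)
    show "submodule {w \<in> carrier V. ract V w x \<in> inner_core} F V"
      using x K by (intro V.submodule_vimage[OF V.module_axioms])
        (auto simp: ract_closed ract_add_left ract_smult_left)
  qed (use x in \<open>simp add: sym_act_closed ract_sym_act V.submoduleD(2)[OF K]\<close>)
  ultimately show ?thesis using K unfolding leibniz_submodule_def by blast
qed

section \<open>The criterion for inner factors\<close>

lemma in_split_ext_submodule:
  assumes "submodule B F V" and C: "submodule C F L"
  shows "submodule (C \<times> B) F (split_ext L V)"
proof -
  interpret X: leibniz_algebra F "split_ext L V" by (fact split_ext_leibniz)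
  note B = V.submoduleD[OF assms(1)] and C = L.submoduleD[OF C]
  show ?thesis
    using B(2,3,5,6) C(2,3,5,6) by (intro X.submoduleI_zero) (auto simp: split_ext_simps)
qed

text \<open>The square of the coset of \<open>(a, v)\<close> is the coset of
  \<open>(aa, sym_act a v)\<close>. Hence all squares lie in the image of \<open>L\<close> plus
  \<open>inner_core\<close>, and conversely differences of squares recover every
  \<open>(0, sym_act a v)\<close>. Passing to the quotient adds \<open>B\<close>.\<close>

lemma inner_factor_iff:
  assumes A: "submodule A F V" and B: "leibniz_submodule F L V B"
  shows "inner_factor F L V A B \<longleftrightarrow> A \<subseteq> inner_core <+>\<^bsub>V\<^esub> B"
proof -
  interpret X: leibniz_algebra F "split_ext L V" by (fact split_ext_leibniz)
  define X where "X = split_ext L V"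
  define I where "I = {\<zero>\<^bsub>L\<^esub>} \<times> B"
  define Q where "Q = quot_algebra X I"
  \<comment> \<open>Unlike the K of the overview, this \<open>K\<close> already includes
    \<open>B\<close>.\<close>
  define K where "K = inner_core <+>\<^bsub>V\<^esub> B"
  let ?\<pi> = "\<lambda>x. I +>\<^bsub>X\<^esub> x"
  note X = split_ext_simps[folded X_def]
  have B': "submodule B F V" using B by (simp add: leibniz_submodule_def)
  note BD = V.submoduleD[OF B'] and AD = V.submoduleD[OF A]
  have Isub: "submodule I F X"
    unfolding I_def X_def using B' L.submoduleI_zero[of "{\<zero>\<^bsub>L\<^esub>}"]
    by (intro in_split_ext_submodule) auto
  have core: "submodule inner_core F V"
    using inner_core_submodule by (simp add: leibniz_submodule_def)
  then have K: "submodule K F V" unfolding K_def using B' by (rule V.submodule_set_add)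
  note KD = V.submoduleD[OF K]
  have core_K: "inner_core \<subseteq> K" and B_K: "B \<subseteq> K"
    unfolding K_def using core B' by (rule V.set_add_superset)+
  note quot = X.quotient_module[of I Q, folded X_def, OF Isub]
  have Qeqs: "carrier Q = a_rcosets\<^bsub>X\<^esub> I" "zero Q = I" "add Q = set_add X"
    "smult Q = (\<lambda>k C. \<Union>x\<in>C. I +>\<^bsub>X\<^esub> (k \<odot>\<^bsub>X\<^esub> x))"
    by (simp_all add: Q_def quot_algebra_def)
  note Qc = quot(1)[OF Qeqs] and Qa = quot(2)[OF Qeqs] and Qs = quot(3)[OF Qeqs]
  interpret Q: module F Q using quot(4)[OF Qeqs] .
  have Qm: "?\<pi> x \<otimes>\<^bsub>Q\<^esub> ?\<pi> y = ?\<pi> (x \<otimes>\<^bsub>X\<^esub> y)" if "x \<in> carrier X" "y \<in> carrier X" for x y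
    unfolding Q_def X_def
  proof (rule X.quot_algebra_mult)
    show "submodule I F (split_ext L V)" using Isub by (simp add: X_def)
    \<comment> \<open>\<open>I\<close> is an ideal: its elements have \<open>L\<close>-part zero, so
      in either product only an action on an element of \<open>B\<close> survives.\<close>
    fix a i assume "a \<in> carrier (split_ext L V)" "i \<in> I"
    then show "a \<otimes>\<^bsub>split_ext L V\<^esub> i \<in> I" "i \<otimes>\<^bsub>split_ext L V\<^esub> a \<in> I"
      using B BD(3) unfolding I_def leibniz_submodule_def
      by (auto simp: split_ext_simps lact_null ract_null L.prod_zero)
  qed (use that in \<open>simp_all add: X_def\<close>)
  have \<pi>c: "?\<pi> x \<in> carrier Q" if "x \<in> carrier X" for x using that Qc by simp
  have "inner_factor F L V A B \<longleftrightarrow> (\<forall>a\<in>A. ?\<pi> (\<zero>\<^bsub>L\<^esub>, a) \<in> Leib F Q)"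
    by (auto simp: inner_factor_def in_split_ext_def I_def Q_def X_def)
  also have "\<dots> \<longleftrightarrow> A \<subseteq> K"
  proof
    assume inner: "\<forall>a\<in>A. ?\<pi> (\<zero>\<^bsub>L\<^esub>, a) \<in> Leib F Q"
    \<comment> \<open>An upper bound for the Leibniz kernel of the quotient: squares have arbitrary
      \<open>L\<close>-part but \<open>V\<close>-part in \<open>K\<close>.\<close>
    have T: "submodule (?\<pi> ` (carrier L \<times> K)) F Q"
      using X.submodule_image[folded X_def, OF Q.module_axioms, of ?\<pi>] \<pi>c Qa Qs
        in_split_ext_submodule[OF K L.carrier_is_submodule, folded X_def]
      by blast
    have sq: "C \<otimes>\<^bsub>Q\<^esub> C \<in> ?\<pi> ` (carrier L \<times> K)" if C: "C \<in> carrier Q" for C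
    proof -
      obtain a v where av: "a \<in> carrier L" "v \<in> carrier V" "C = ?\<pi> (a, v)"
        using C Qc X(1) by auto
      then have "C \<otimes>\<^bsub>Q\<^esub> C = ?\<pi> (a \<otimes>\<^bsub>L\<^esub> a, sym_act a v)"
        using Qm[of "(a, v)" "(a, v)"] by (simp add: X sym_act_def)
      then show ?thesis
        using av core_K sym_act_in_inner_core L.prod_closed by blast
    qed
    have "Leib F Q \<subseteq> ?\<pi> ` (carrier L \<times> K)"
      unfolding Leib_def using T sq by (intro Q.lin_span_least) auto
    moreover have "a \<in> K" if a: "a \<in> A" and im: "?\<pi> (\<zero>\<^bsub>L\<^esub>, a) \<in> ?\<pi> ` (carrier L \<times> K)" for a
    proof -
      obtain l u where lu: "l \<in> carrier L" "u \<in> K" "?\<pi> (\<zero>\<^bsub>L\<^esub>, a) = ?\<pi> (l, u)"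
        using im by auto
      \<comment> \<open>Equality of the cosets writes \<open>(0, a)\<close> as
        \<open>(0, b) + (l, u)\<close> with \<open>b\<close> in \<open>B\<close>; the ambiguity
        \<open>b\<close> is harmless because \<open>B\<close> lies in \<open>K\<close>.\<close>
      have "(\<zero>\<^bsub>L\<^esub>, a) \<in> ?\<pi> (\<zero>\<^bsub>L\<^esub>, a)"
        using X.coset_self[folded X_def, OF Isub] AD(3)[OF a] by (simp add: X)
      then have "(\<zero>\<^bsub>L\<^esub>, a) \<in> ?\<pi> (l, u)" using lu(3) by simp
      then obtain b where "b \<in> B" "a = b \<oplus>\<^bsub>V\<^esub> u"
        unfolding a_r_coset_def' I_def by (auto simp: X)
      then show ?thesis using KD(5) B_K lu(2) by auto
    qed
    ultimately show "A \<subseteq> K" using inner by blast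
  next
    assume AK: "A \<subseteq> K"
    \<comment> \<open>The span is an intersection, so membership is tested against an arbitrary
      subspace \<open>N\<close> containing all squares.\<close>
    have "?\<pi> (\<zero>\<^bsub>L\<^esub>, a) \<in> N"
      if a: "a \<in> A" and N: "submodule N F Q" and sq: "\<And>C. C \<in> carrier Q \<Longrightarrow> C \<otimes>\<^bsub>Q\<^esub> C \<in> N" for a N
    proof -
      note ND = Q.submoduleD[OF N]
      define P where "P = {v \<in> carrier V. ?\<pi> (\<zero>\<^bsub>L\<^esub>, v) \<in> N}"
      have P: "submodule P F V" unfolding P_def
      proof (rule V.submodule_vimage[OF Q.module_axioms _ _ _ N])
        fix v w assume "v \<in> carrier V" "w \<in> carrier V"
        then show "?\<pi> (\<zero>\<^bsub>L\<^esub>, v \<oplus>\<^bsub>V\<^esub> w) = ?\<pi> (\<zero>\<^bsub>L\<^esub>, v) \<oplus>\<^bsub>Q\<^esub> ?\<pi> (\<zero>\<^bsub>L\<^esub>, w)"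
          using Qa[of "(\<zero>\<^bsub>L\<^esub>, v)" "(\<zero>\<^bsub>L\<^esub>, w)"] by (simp add: X)
      next
        fix k v assume "k \<in> carrier F" "v \<in> carrier V"
        then show "?\<pi> (\<zero>\<^bsub>L\<^esub>, k \<odot>\<^bsub>V\<^esub> v) = k \<odot>\<^bsub>Q\<^esub> ?\<pi> (\<zero>\<^bsub>L\<^esub>, v)"
          using Qs[of k "(\<zero>\<^bsub>L\<^esub>, v)"] by (simp add: X)
      qed (auto simp: X \<pi>c)
      have "sym_act c v \<in> P" if cv: "c \<in> carrier L" "v \<in> carrier V" for c v
      proof -
        let ?x = "?\<pi> (\<zero>\<^bsub>L\<^esub>, sym_act c v)" and ?y = "?\<pi> (c \<otimes>\<^bsub>L\<^esub> c, \<zero>\<^bsub>V\<^esub>)"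
        have y: "?y \<in> N"
          using sq[of "?\<pi> (c, \<zero>\<^bsub>V\<^esub>)"] Qm[of "(c, \<zero>\<^bsub>V\<^esub>)" "(c, \<zero>\<^bsub>V\<^esub>)"] cv
          by (simp add: X \<pi>c lact_zero ract_zero)
        have "?y \<oplus>\<^bsub>Q\<^esub> ?x = ?\<pi> (c \<otimes>\<^bsub>L\<^esub> c, sym_act c v)"
          using Qa[of "(c \<otimes>\<^bsub>L\<^esub> c, \<zero>\<^bsub>V\<^esub>)" "(\<zero>\<^bsub>L\<^esub>, sym_act c v)"] cv
          by (simp add: X L.prod_closed sym_act_closed)
        also have "\<dots> \<in> N"
          using sq[of "?\<pi> (c, v)"] Qm[of "(c, v)" "(c, v)"] cv
          by (simp add: X \<pi>c sym_act_def)
        finally \<comment> \<open>\<open>cv + vc = (c + v)\<^sup>2 - c\<^sup>2\<close>\<close>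
        have "\<ominus>\<^bsub>Q\<^esub> ?y \<oplus>\<^bsub>Q\<^esub> (?y \<oplus>\<^bsub>Q\<^esub> ?x) \<in> N" using ND(4,5) y by blast
        moreover have "?x \<in> carrier Q" using \<pi>c cv by (simp add: X sym_act_closed)
        ultimately have "?x \<in> N" using ND(3)[OF y] by (simp add: Q.M.r_neg1)
        then show ?thesis using cv by (simp add: P_def sym_act_closed)
      qed
      then have "inner_core \<subseteq> P" using P by (rule inner_core_least[rotated])
      moreover have "B \<subseteq> P"
      proof
        fix b assume b: "b \<in> B"
        then have "?\<pi> (\<zero>\<^bsub>L\<^esub>, b) = I"
          using X.coset_eq_self_iff[folded X_def, OF Isub, of "(\<zero>\<^bsub>L\<^esub>, b)"] BD(3)
          by (simp add: X I_def)
        then show "b \<in> P" using ND(2) BD(3)[OF b] by (simp add: P_def Qeqs(2))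
      qed
      ultimately have "K \<subseteq> P" unfolding K_def using P V.set_add_least by blast
      then show ?thesis using a AK by (auto simp: P_def)
    qed
    then show "\<forall>a\<in>A. ?\<pi> (\<zero>\<^bsub>L\<^esub>, a) \<in> Leib F Q"
      unfolding Leib_def lin_span_def by blast
  qed
  finally show ?thesis unfolding K_def .
qed

section \<open>Existence of composition factors\<close>

lemma leibniz_submodule_Inter:
  assumes "\<And>N. N \<in> \<N> \<Longrightarrow> leibniz_submodule F L V N" "\<N> \<noteq> {}"
  shows "leibniz_submodule F L V (\<Inter>\<N>)"
  using assms V.submodule_Inter[of \<N>] unfolding leibniz_submodule_def by simp

text \<open>The chain condition puts any two vectors into a common member, so sums stay in the
  union. This supplies the upper bounds for Zorn's lemma.\<close>

lemma leibniz_submodule_chain_Union: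
  assumes "\<And>N. N \<in> \<N> \<Longrightarrow> leibniz_submodule F L V N" "\<N> \<noteq> {}"
    and chain: "\<And>M N. \<lbrakk>M \<in> \<N>; N \<in> \<N>\<rbrakk> \<Longrightarrow> M \<subseteq> N \<or> N \<subseteq> M"
  shows "leibniz_submodule F L V (\<Union>\<N>)"
proof -
  have N: "submodule N F V" if "N \<in> \<N>" for N using that assms(1) by (simp add: leibniz_submodule_def)
  have "submodule (\<Union>\<N>) F V"
  proof (rule V.submoduleI_zero)
    show "\<Union>\<N> \<subseteq> carrier V" using V.submoduleD(1)[OF N] by blast
    show "\<zero>\<^bsub>V\<^esub> \<in> \<Union>\<N>" using V.submoduleD(2)[OF N] assms(2) by blast
    show "x \<oplus>\<^bsub>V\<^esub> y \<in> \<Union>\<N>" if xy: "x \<in> \<Union>\<N>" "y \<in> \<Union>\<N>" for x y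
    proof -
      obtain S where "S \<in> \<N>" "x \<in> S" "y \<in> S" using xy chain by blast
      then show ?thesis using V.submoduleD(5)[OF N] by blast
    qed
    show "k \<odot>\<^bsub>V\<^esub> x \<in> \<Union>\<N>" if "k \<in> carrier F" "x \<in> \<Union>\<N>" for k x
      using that V.submoduleD(6)[OF N] by blast
  qed
  then show ?thesis using assms(1) unfolding leibniz_submodule_def by blast
qed

text \<open>Correspondence of submodules: a submodule of \<open>A/B\<close> pulls back to one
  between \<open>B\<close> and \<open>A\<close>. If only the two ends occur, the original submodule
  is zero or everything.\<close>

lemma composition_factorI:
  assumes A: "leibniz_submodule F L V A" and B: "leibniz_submodule F L V B" and BA: "B \<subset> A"
    and max: "\<And>C. \<lbrakk>leibniz_submodule F L V C; B \<subseteq> C; C \<subseteq> A\<rbrakk> \<Longrightarrow> C = B \<or> C = A"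
  shows "composition_factor F L V A B"
proof -
  define VA where "VA = V\<lparr>carrier := A\<rparr>"
  define Q where "Q = quot_bimodule VA B"
  have A': "submodule A F V" and B': "submodule B F V"
    using A B by (simp_all add: leibniz_submodule_def)
  interpret VA: module F VA
    unfolding VA_def using submodule.submodule_is_module[OF A' V.module_axioms] .
  have VA: "carrier VA = A" "add VA = add V" "smult VA = smult V" "lact VA = lact V" "ract VA = ract V"
    by (simp_all add: VA_def)
  note restrict = V.submodule_restrict_iff[OF A', folded VA_def]
  have Bsub: "submodule B F VA" using restrict B' BA by blast
  let ?\<pi> = "\<lambda>x. B +>\<^bsub>VA\<^esub> x"
  have Qeqs: "carrier Q = a_rcosets\<^bsub>VA\<^esub> B" "zero Q = B" "add Q = set_add VA"
    "smult Q = (\<lambda>k C. \<Union>x\<in>C. B +>\<^bsub>VA\<^esub> (k \<odot>\<^bsub>VA\<^esub> x))"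
    by (simp_all add: Q_def quot_bimodule_def)
  note quot = VA.quotient_module[of B Q, OF Bsub]
  note Qc = quot(1)[OF Qeqs] and Qa = quot(2)[OF Qeqs] and Qs = quot(3)[OF Qeqs]
  interpret Q: module F Q using quot(4)[OF Qeqs] .
  have inA: "lact V x v \<in> A" "ract V v x \<in> A" if "x \<in> carrier L" "v \<in> A" for x v
    using A that by (auto simp: leibniz_submodule_def)
  have inB: "lact V x v \<in> B" "ract V v x \<in> B" if "x \<in> carrier L" "v \<in> B" for x v
    using B that by (auto simp: leibniz_submodule_def)
  have AV: "v \<in> carrier V" if "v \<in> A" for v using V.submoduleD(3)[OF A' that] .
  have BV: "v \<in> carrier V" if "v \<in> B" for v using V.submoduleD(3)[OF B' that] .
  \<comment> \<open>Replacing \<open>v\<close> by \<open>i + v\<close> with \<open>i\<close> in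
    \<open>B\<close> changes the result by an element of the invariant subspace \<open>B\<close>, so
    the union over representatives is a single coset.\<close>
  have Ql: "lact Q x (?\<pi> v) = ?\<pi> (lact V x v)" if x: "x \<in> carrier L" and v: "v \<in> A" for x v
  proof -
    have "?\<pi> (lact V x (i \<oplus>\<^bsub>VA\<^esub> v)) = ?\<pi> (lact V x v)" if "i \<in> B" for i
      using VA.coset_absorb[OF Bsub, of "lact V x i" "lact V x v"] that x v
      by (simp add: VA lact_add_right AV BV inA inB)
    then have "(\<Union>y\<in>?\<pi> v. ?\<pi> (lact V x y)) = ?\<pi> (lact V x v)"
      by (rule VA.UN_coset_const[OF Bsub])
    then show ?thesis by (simp add: Q_def quot_bimodule_def VA)
  qed
  have Qr: "ract Q (?\<pi> v) x = ?\<pi> (ract V v x)" if x: "x \<in> carrier L" and v: "v \<in> A" for x v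
  proof -
    have "?\<pi> (ract V (i \<oplus>\<^bsub>VA\<^esub> v) x) = ?\<pi> (ract V v x)" if "i \<in> B" for i
      using VA.coset_absorb[OF Bsub, of "ract V i x" "ract V v x"] that x v
      by (simp add: VA ract_add_left AV BV inA inB)
    then have "(\<Union>y\<in>?\<pi> v. ?\<pi> (ract V y x)) = ?\<pi> (ract V v x)"
      by (rule VA.UN_coset_const[OF Bsub])
    then show ?thesis by (simp add: Q_def quot_bimodule_def VA)
  qed
  have "U = {\<zero>\<^bsub>Q\<^esub>} \<or> U = carrier Q" if U: "leibniz_submodule F L Q U" for U
  proof -
    define C where "C = {v \<in> A. ?\<pi> v \<in> U}"
    have Us: "submodule U F Q" using U by (simp add: leibniz_submodule_def)
    note UD = Q.submoduleD[OF Us]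
    have "submodule C F VA"
      using VA.submodule_vimage[OF Q.module_axioms _ _ _ Us, of ?\<pi>] Qc Qa Qs
      unfolding C_def VA by blast
    then have "submodule C F V" using restrict by blast
    moreover have "lact V x v \<in> C \<and> ract V v x \<in> C" if "x \<in> carrier L" "v \<in> C" for x v
      using that U unfolding leibniz_submodule_def C_def by (auto simp: inA simp flip: Ql Qr)
    ultimately have C: "leibniz_submodule F L V C" by (simp add: leibniz_submodule_def)
    have "B \<subseteq> C"
    proof
      fix b assume b: "b \<in> B"
      then have "?\<pi> b = B" using VA.coset_eq_self_iff[OF Bsub, of b] BA by (auto simp: VA)
      then show "b \<in> C" using UD(2) b BA by (auto simp: C_def Qeqs(2))
    qed
    then consider "C = B" | "C = A" using max[OF C] by (auto simp: C_def)
    then show ?thesis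
    proof cases
      case 1
      have "D = \<zero>\<^bsub>Q\<^esub>" if D: "D \<in> U" for D
      proof -
        obtain v where v: "v \<in> A" "D = ?\<pi> v" using UD(3)[OF D] Qc by (auto simp: VA)
        then have "v \<in> B" using D 1 by (auto simp: C_def)
        then show ?thesis using VA.coset_eq_self_iff[OF Bsub, of v] v by (simp add: VA Qeqs(2))
      qed
      then show ?thesis using UD(2) by blast
    next
      case 2
      then have "carrier Q \<subseteq> U" unfolding Qc VA C_def by blast
      then show ?thesis using UD(1) by blast
    qed
  qed
  moreover have "carrier Q \<noteq> {\<zero>\<^bsub>Q\<^esub>}"
  proof
    assume eq: "carrier Q = {\<zero>\<^bsub>Q\<^esub>}"
    obtain v where v: "v \<in> A" "v \<notin> B" using BA by blast
    then have "?\<pi> v \<in> carrier Q" using Qc by (simp add: VA)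
    then have "?\<pi> v = B" using eq by (simp add: Qeqs(2))
    then show False using VA.coset_eq_self_iff[OF Bsub, of v] v by (simp add: VA)
  qed
  ultimately have "irreducible_bimodule F L Q" by (simp add: irreducible_bimodule_def)
  then show ?thesis using A B BA by (simp add: composition_factor_def Q_def VA_def)
qed

text \<open>Zorn's lemma covers modules of infinite length. The top of the factor is generated by
  \<open>v\<close> over its bottom \<open>B\<close>, so a submodule in between either contains
  \<open>v\<close> and is the top, or avoids \<open>v\<close> and equals \<open>B\<close> by
  maximality.\<close>

lemma composition_factor_between:
  assumes W: "leibniz_submodule F L V W" and P: "leibniz_submodule F L V P"
    and WP: "W \<subset> P"
  obtains A B where "composition_factor F L V A B" "W \<subseteq> B" "A \<subseteq> P"
proof -
  obtain v where v: "v \<in> P" "v \<notin> W" using WP by blast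
  define S where "S = {B. leibniz_submodule F L V B \<and> W \<subseteq> B \<and> B \<subseteq> P \<and> v \<notin> B}"
  have "\<exists>B\<in>S. \<forall>C\<in>S. B \<subseteq> C \<longrightarrow> C = B"
  proof (rule subset_Zorn_nonempty)
    show "S \<noteq> {}" using W WP v by (auto simp: S_def)
    fix \<C> assume \<C>: "\<C> \<noteq> {}" "subset.chain S \<C>"
    then have "leibniz_submodule F L V (\<Union>\<C>)"
      by (intro leibniz_submodule_chain_Union) (auto simp: subset_chain_def S_def)
    then show "\<Union>\<C> \<in> S" using \<C> unfolding subset_chain_def S_def by blast
  qed
  then obtain B where B: "B \<in> S" "\<And>C. \<lbrakk>C \<in> S; B \<subseteq> C\<rbrakk> \<Longrightarrow> C = B" by blast
  \<comment> \<open>\<open>B\<close> is maximal without \<open>v\<close>, so the submodule generated by \<open>B\<close> and \<open>v\<close> covers \<open>B\<close>.\<close>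
  define \<N> where "\<N> = {C. leibniz_submodule F L V C \<and> B \<subseteq> C \<and> v \<in> C}"
  \<comment> \<open>\<open>P\<close> makes the family nonempty and bounds its intersection from
    above.\<close>
  have PN: "P \<in> \<N>" using P B(1) v by (auto simp: \<N>_def S_def)
  have "composition_factor F L V (\<Inter>\<N>) B"
  proof (rule composition_factorI)
    show "leibniz_submodule F L V (\<Inter>\<N>)"
      using PN by (intro leibniz_submodule_Inter) (auto simp: \<N>_def)
    show "leibniz_submodule F L V B" using B(1) by (simp add: S_def)
    show "B \<subset> \<Inter>\<N>" using B(1) unfolding \<N>_def S_def by blast
    fix C assume C: "leibniz_submodule F L V C" "B \<subseteq> C" "C \<subseteq> \<Inter>\<N>"
    show "C = B \<or> C = \<Inter>\<N>"
    proof (cases "v \<in> C")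
      case True
      then have "C \<in> \<N>" using C by (simp add: \<N>_def)
      then show ?thesis using C(3) by blast
    next
      case False
      then have "C \<in> S" using C B(1) PN unfolding S_def by blast
      then show ?thesis using B(2) C(2) by blast
    qed
  qed
  moreover have "W \<subseteq> B" using B(1) by (simp add: S_def)
  moreover have "\<Inter>\<N> \<subseteq> P" using PN by blast
  ultimately show thesis using that by blast
qed

section \<open>Existence and uniqueness of the splitting submodule\<close>

definition splits_inner_outer :: "'v set \<Rightarrow> bool" where
  "splits_inner_outer W \<longleftrightarrow> leibniz_submodule F L V W \<and>
    (\<forall>A B. composition_factor F L V A B \<and> A \<subseteq> W \<longrightarrow> inner_factor F L V A B) \<and>
    (\<forall>A B. composition_factor F L V A B \<and> W \<subseteq> B \<longrightarrow> outer_factor F L V A B)"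

lemma composition_factor_inner_iff:
  assumes "composition_factor F L V A B"
  shows "inner_factor F L V A B \<longleftrightarrow> A \<subseteq> inner_core <+>\<^bsub>V\<^esub> B"
  using assms by (intro inner_factor_iff) (auto simp: composition_factor_def leibniz_submodule_def)

text \<open>Below the core, \<open>A\<close> lies in \<open>inner_core\<close> and so in its sum
  with \<open>B\<close>. Above it, that sum is contained in \<open>B\<close>, which is properly
  smaller than \<open>A\<close>.\<close>

lemma splits_inner_core: "splits_inner_outer inner_core"
  unfolding splits_inner_outer_def
proof (intro conjI allI impI inner_core_submodule)
  have K: "submodule inner_core F V" using inner_core_submodule by (simp add: leibniz_submodule_def)
  fix A B
  show "inner_factor F L V A B" if AB: "composition_factor F L V A B \<and> A \<subseteq> inner_core"
  proof -
    have "submodule B F V" using AB by (simp add: composition_factor_def leibniz_submodule_def)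
    then show ?thesis
      using AB composition_factor_inner_iff[of A B] V.set_add_superset(1)[OF K] by blast
  qed
  show "outer_factor F L V A B" if AB: "composition_factor F L V A B \<and> inner_core \<subseteq> B"
  proof -
    have "submodule B F V" "B \<subset> A" using AB by (auto simp: composition_factor_def leibniz_submodule_def)
    then show ?thesis
      using AB composition_factor_inner_iff[of A B] V.set_add_least[of B inner_core B] by blast
  qed
qed

text \<open>A failure of either inclusion leaves room for a composition factor of the wrong
  kind.\<close>

lemma splits_inner_outer_unique:
  assumes W: "splits_inner_outer W"
  shows "W = inner_core"
proof -
  note core = inner_core_submodule
  have Wl: "leibniz_submodule F L V W" using W by (simp add: splits_inner_outer_def)
  have K: "submodule inner_core F V" and W': "submodule W F V"
    using core Wl by (simp_all add: leibniz_submodule_def)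
  have "inner_core \<subseteq> W"
  proof (rule ccontr)
    let ?P = "inner_core <+>\<^bsub>V\<^esub> W"
    assume "\<not> inner_core \<subseteq> W"
    then have "W \<subset> ?P" using V.set_add_superset[OF K W'] by blast
    moreover have "leibniz_submodule F L V ?P"
      using V.submodule_set_add[OF K W'] core Wl V.submoduleD(3)[OF K] V.submoduleD(3)[OF W']
      by (auto simp: leibniz_submodule_def lact_add_right ract_add_left intro!: V.set_addI elim!: V.set_addE)
    ultimately obtain A B where AB: "composition_factor F L V A B" "W \<subseteq> B" "A \<subseteq> ?P"
      using composition_factor_between[OF Wl] by blast
    \<comment> \<open>Enlarging \<open>W\<close> to \<open>B\<close> puts \<open>A\<close> inside
      \<open>inner_core\<close> plus \<open>B\<close>, so a factor above \<open>W\<close> would be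
      inner.\<close>
    have "?P \<subseteq> inner_core <+>\<^bsub>V\<^esub> B" using AB(2) by (auto simp: set_add_def')
    then have "inner_factor F L V A B" using AB composition_factor_inner_iff by blast
    then show False using W AB by (auto simp: splits_inner_outer_def)
  qed
  moreover have "W \<subseteq> inner_core"
  proof (rule ccontr)
    assume "\<not> W \<subseteq> inner_core"
    \<comment> \<open>The first inclusion makes the containment of \<open>inner_core\<close> in
      \<open>W\<close> proper here, and the splitting property of \<open>inner_core\<close> makes
      the resulting factor outer.\<close>
    then obtain A B where AB: "composition_factor F L V A B" "inner_core \<subseteq> B" "A \<subseteq> W"
      using composition_factor_between[OF core Wl] \<open>inner_core \<subseteq> W\<close> by blast
    then have "outer_factor F L V A B" using splits_inner_core by (auto simp: splits_inner_outer_def)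
    then show False using W AB by (auto simp: splits_inner_outer_def)
  qed
  ultimately show ?thesis by blast
qed

end

theorem theorem1p10:
  fixes F :: "('f, 'm) ring_scheme"
    and L :: "('f, 'a, 'n) module_scheme"
    and V :: "('f, 'v, 'a, 'p) bimodule_scheme"
  assumes "leibniz_algebra F L" and "leibniz_module F L V"
  shows "\<exists>!W. leibniz_submodule F L V W \<and>
    (\<forall>A B. composition_factor F L V A B \<and> A \<subseteq> W \<longrightarrow> inner_factor F L V A B) \<and>
    (\<forall>A B. composition_factor F L V A B \<and> W \<subseteq> B \<longrightarrow> outer_factor F L V A B)"
proof -
  interpret leibniz_module F L V by fact
  show ?thesis
    using splits_inner_core splits_inner_outer_unique
    unfolding splits_inner_outer_def[abs_def] by (intro ex1I) blast+
qed

end
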